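(* For any integers $r,t\ge1$, any real $a\in(3/2,2]$ and any $\gamma>0$, there exists $n_0$ such that for all $n\ge n_0$, every digraph $G$ on $n$ vertices with $e_a(G)\ge a\,t_r(n)+\gamma n^2$ contains $T_{r+1}^t$ as a subdigraph.
   Context: A digraph has no loops and at most one arc in each direction between two vertices. For a digraph $G$, $f_1(G)$ is the number of unordered pairs $\{u,v\}$ such that exactly one of $uv,vu$ is an arc, and $f_2(G)$ is the number of unordered pairs with both $uv$ and $vu$ arcs. For real $a\ge1$, $e_a(G):=a\,f_2(G)+f_1(G)$. $t_r(n)$ is the number of edges of the $r$-partite Turán graph on $n$ vertices (complete $r$-partite graph with parts as equal as possible). $T_{r+1}^t$ is the digraph obtained from the transitive tournament $T_{r+1}$ by replacing each vertex with an independent set of size $t$ and, for each arc $ij$ of $T_{r+1}$, adding all arcs from the $i$-th set to the $j$-th set. *)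

theory Defs
  imports Main Complex_Main
begin

definition digraph :: "'a set \<Rightarrow> ('a \<times> 'a) set \<Rightarrow> bool" where
  "digraph V A \<longleftrightarrow> finite V \<and> A \<subseteq> V \<times> V \<and> (\<forall>v. (v, v) \<notin> A)"

definition f1 :: "('a \<times> 'a) set \<Rightarrow> nat" where
  "f1 A = card {{u, v} | u v. (u, v) \<in> A \<and> (v, u) \<notin> A}"

definition f2 :: "('a \<times> 'a) set \<Rightarrow> nat" where
  "f2 A = card {{u, v} | u v. (u, v) \<in> A \<and> (v, u) \<in> A}"

definition e_a :: "real \<Rightarrow> ('a \<times> 'a) set \<Rightarrow> real" where
  "e_a a A = a * real (f2 A) + real (f1 A)"

text \<open>Turan number: edges of the complete r-partite graph on n vertices with parts as
  equal as possible; part i (i < r) has size n div r + (1 if i < n mod r).\<close>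
definition turan_part :: "nat \<Rightarrow> nat \<Rightarrow> nat \<Rightarrow> nat" where
  "turan_part r n i = n div r + (if i < n mod r then 1 else 0)"

definition turan_num :: "nat \<Rightarrow> nat \<Rightarrow> nat" where
  "turan_num r n = (\<Sum>(i, j) \<in> {(i, j). i < j \<and> j < r}. turan_part r n i * turan_part r n j)"

text \<open>The blow-up T_{r+1}^t of the transitive tournament T_{r+1} (vertices 0..r, arcs i \<rightarrow> j for i < j):
  vertex (i,k) is the k-th copy of vertex i.\<close>
definition blowup_vertices :: "nat \<Rightarrow> nat \<Rightarrow> (nat \<times> nat) set" where
  "blowup_vertices r t = {(i, k). i < r + 1 \<and> k < t}"

definition blowup_arcs :: "nat \<Rightarrow> nat \<Rightarrow> ((nat \<times> nat) \<times> (nat \<times> nat)) set" where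
  "blowup_arcs r t = {((i, k), (j, l)). i < j \<and> j < r + 1 \<and> k < t \<and> l < t}"

definition contains_subdigraph ::
  "'a set \<Rightarrow> ('a \<times> 'a) set \<Rightarrow> 'b set \<Rightarrow> ('b \<times> 'b) set \<Rightarrow> bool" where
  "contains_subdigraph V A W B \<longleftrightarrow>
     (\<exists>f. inj_on f W \<and> f ` W \<subseteq> V \<and> (\<forall>(x, y) \<in> B. (f x, f y) \<in> A))"

end

theory Submission
  imports Defs "HOL-Library.FuncSet"
begin

text \<open>
  Sample vertices \<open>\<phi> 0, \<dots>, \<phi> (m - 1)\<close> independently and keep the index \<open>i\<close> if \<open>\<phi> i\<close> dominates all
  earlier vertices or is dominated by all of them. The kept vertices span a transitive tournament,
  since each of them can be put at the top or at the bottom of the order built so far. A vertex \<open>v\<close>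
  with normalised outdegree \<open>q1\<close>, indegree \<open>q2\<close> and number of double neighbours \<open>q3\<close> contributes about
  \<open>1 / (1 - q1) + 1 / (1 - q2) - 1 / (1 - q3)\<close> to \<open>n\<close> times the expected number of kept indices,
  which is at least \<open>1 / \<delta> v\<close>, where \<open>\<delta> v\<close> is the density of non-neighbours plus a third of that of the
  single neighbours. The weight hypothesis bounds the average of \<open>\<delta>\<close> below \<open>1 / r\<close>, so by convexity
  more than \<open>r\<close> indices are kept on average, and a positive proportion of the \<open>(r + 1)\<close>-tuples
  of vertices are transitive tournaments. Erdos's theorem on complete \<open>k\<close>-partite \<open>k\<close>-uniform
  hypergraphs turns this positive density into a blow-up.
\<close>

section \<open>Counting arcs by degrees and by single and double pairs\<close>

lemma card_arcs_eq_sum_out: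
  assumes "finite V" "A \<subseteq> V \<times> V"
  shows "card A = (\<Sum>v\<in>V. card {u. (v, u) \<in> A})"
proof -
  have A: "A = Sigma V (\<lambda>v. {u. (v, u) \<in> A})" using assms(2) by auto
  have "finite {u. (v, u) \<in> A}" for v
    by (rule finite_subset[OF _ assms(1)]) (use assms(2) in auto)
  then show ?thesis using assms(1) by (subst A) simp
qed

lemma card_arcs_eq_sum_in:
  assumes "finite V" "A \<subseteq> V \<times> V"
  shows "card A = (\<Sum>v\<in>V. card {u. (u, v) \<in> A})"
proof -
  have "A\<inverse> \<subseteq> V \<times> V" using assms(2) by auto
  from card_arcs_eq_sum_out[OF assms(1) this] show ?thesis
    by (simp add: card_inverse)
qed

lemma f1_eq_card:
  assumes "\<forall>v. (v, v) \<notin> A"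
  shows "f1 A = card (A - A\<inverse>)"
proof -
  have "{{u, v} | u v. (u, v) \<in> A \<and> (v, u) \<notin> A} = (\<lambda>(u, v). {u, v}) ` (A - A\<inverse>)"
    by auto
  moreover have "inj_on (\<lambda>(u, v). {u, v}) (A - A\<inverse>)"
    by (auto simp: inj_on_def doubleton_eq_iff)
  ultimately show ?thesis by (simp add: f1_def card_image)
qed

lemma double_f2_eq_card:
  assumes "\<forall>v. (v, v) \<notin> A" "finite A"
  shows "2 * f2 A = card (A \<inter> A\<inverse>)"
proof -
  let ?P = "{{u, v} | u v. (u, v) \<in> A \<and> (v, u) \<in> A}"
  have P: "?P = (\<lambda>(u, v). {u, v}) ` (A \<inter> A\<inverse>)" by auto
  have two: "card {x \<in> A \<inter> A\<inverse>. (\<lambda>(u, v). {u, v}) x = p} = 2" if "p \<in> ?P" for p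
  proof -
    from that obtain u v where uv: "p = {u, v}" "(u, v) \<in> A" "(v, u) \<in> A" by auto
    have "{x \<in> A \<inter> A\<inverse>. (\<lambda>(u, v). {u, v}) x = {u, v}} = {(u, v), (v, u)}" (is "?L = ?R")
    proof
      show "?L \<subseteq> ?R" by (clarsimp simp: doubleton_eq_iff)
      show "?R \<subseteq> ?L" using uv(2,3) by auto
    qed
    moreover have "u \<noteq> v" using uv assms(1) by auto
    ultimately show ?thesis by (simp add: uv(1))
  qed
  have "card (A \<inter> A\<inverse>) = (\<Sum>p\<in>?P. card {x \<in> A \<inter> A\<inverse>. (\<lambda>(u, v). {u, v}) x = p})"
    using sum.image_gen[of "A \<inter> A\<inverse>" "\<lambda>_. 1::nat" "\<lambda>(u, v). {u, v}"] assms(2)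
    unfolding P by simp
  also have "\<dots> = (\<Sum>p\<in>?P. 2)" by (rule sum.cong[OF refl two])
  finally show ?thesis by (simp add: f2_def)
qed

lemma card_arcs_eq_f1_f2:
  assumes "\<forall>v. (v, v) \<notin> A" "finite A"
  shows "card A = f1 A + 2 * f2 A"
proof -
  have "card A = card ((A - A\<inverse>) \<union> (A \<inter> A\<inverse>))" by (rule arg_cong[of _ _ card]) blast
  also have "\<dots> = card (A - A\<inverse>) + card (A \<inter> A\<inverse>)"
    by (rule card_Un_disjoint) (use assms(2) in auto)
  finally show ?thesis using f1_eq_card[OF assms(1)] double_f2_eq_card[OF assms] by simp
qed

section \<open>Lower bound for the Turan number\<close>

lemma sum_square_pairs:
  fixes p :: "nat \<Rightarrow> 'b::comm_semiring_1"
  shows "(\<Sum>i<r. p i)\<^sup>2 = (\<Sum>i<r. (p i)\<^sup>2) + 2 * (\<Sum>(i, j) \<in> {(i, j). i < j \<and> j < r}. p i * p j)"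
proof (induction r)
  case (Suc r)
  have fin: "finite {(i, j). i < j \<and> j < r}"
    by (rule finite_subset[of _ "{..<r} \<times> {..<r}"]) auto
  have "{(i, j). i < j \<and> j < Suc r} = {(i, j). i < j \<and> j < r} \<union> (\<lambda>i. (i, r)) ` {..<r}"
    by (auto simp: less_Suc_eq)
  moreover have "(\<Sum>(i, j) \<in> {(i, j). i < j \<and> j < r} \<union> (\<lambda>i. (i, r)) ` {..<r}. p i * p j) =
      (\<Sum>(i, j) \<in> {(i, j). i < j \<and> j < r}. p i * p j) + (\<Sum>(i, j) \<in> (\<lambda>i. (i, r)) ` {..<r}. p i * p j)"
    by (rule sum.union_disjoint) (use fin in auto)
  moreover have "(\<Sum>(i, j) \<in> (\<lambda>i. (i, r)) ` {..<r}. p i * p j) = (\<Sum>i<r. p i) * p r"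
    by (subst sum.reindex) (auto simp: inj_on_def sum_distrib_right)
  ultimately show ?case using Suc by (simp add: power2_sum algebra_simps)
qed simp

text \<open>With \<open>s = n mod r\<close>, expanding the square of the sum of the part sizes gives
  \<open>2 * turan_num r n = (1 - 1/r) * n^2 - (s - s^2/r)\<close>, and the error term is below
  \<open>r\<close>.\<close>

lemma turan_num_lower:
  assumes "r \<ge> 1"
  shows "2 * real (turan_num r n) \<ge> (1 - 1 / real r) * (real n)\<^sup>2 - real r"
proof -
  define k s where "k = n div r" and "s = n mod r"
  have n: "n = r * k + s" and s: "s < r" using assms by (auto simp: k_def s_def)
  have card_s: "(\<Sum>i<r. if i < s then c else 0) = c * s" for c :: nat
  proof -
    have "(\<Sum>i<r. if i < s then c else 0) = (\<Sum>i\<in>{i \<in> {..<r}. i < s}. c)"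
      by (subst sum.inter_filter) auto
    also have "{i \<in> {..<r}. i < s} = {..<s}" using s by auto
    finally show ?thesis by simp
  qed
  have part: "turan_part r n i = k + (if i < s then 1 else 0)" for i
    by (simp add: turan_part_def k_def s_def)
  have parts: "(\<Sum>i<r. turan_part r n i) = n"
    unfolding part sum.distrib card_s by (simp add: n)
  have "(turan_part r n i)\<^sup>2 = k\<^sup>2 + (if i < s then 2 * k + 1 else 0)" for i
    by (simp add: part power2_eq_square)
  then have sq: "(\<Sum>i<r. (turan_part r n i)\<^sup>2) = r * k\<^sup>2 + (2 * k + 1) * s"
    by (simp only: sum.distrib card_s) simp
  have "n\<^sup>2 = r * k\<^sup>2 + (2 * k + 1) * s + 2 * turan_num r n"
    using sum_square_pairs[of "turan_part r n" r] unfolding parts sq turan_num_def .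
  then have "(real n)\<^sup>2 = r * (real k)\<^sup>2 + (2 * real k + 1) * s + 2 * real (turan_num r n)"
    by (metis (mono_tags, lifting) of_nat_1 of_nat_add of_nat_mult of_nat_numeral of_nat_power)
  moreover have "(real n)\<^sup>2 / r = r * (real k)\<^sup>2 + 2 * real k * s + (real s)\<^sup>2 / r"
    using assms by (simp add: n field_simps power2_eq_square)
  moreover have "(real s)\<^sup>2 / r \<ge> 0" "real s \<le> r" using s by auto
  moreover have "(1 - 1 / real r) * (real n)\<^sup>2 = (real n)\<^sup>2 - (real n)\<^sup>2 / r"
    by (simp add: left_diff_distrib)
  moreover have "(2 * real k + 1) * s = 2 * real k * s + s" by (simp add: distrib_right)
  ultimately show ?thesis by linarith
qed

section \<open>Real inequalities for the contribution of one vertex\<close>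

text \<open>The coefficient 1/3 is the smallest possible for all \<open>x\<close>, \<open>y\<close>, and it is
  \<open>(a - 1) / a\<close> at \<open>a = 3/2\<close>: this is where the threshold on \<open>a\<close> comes from.\<close>

lemma inverse_sum_bound:
  fixes M x y :: real
  assumes "M > 0" "x \<ge> 0" "y \<ge> 0"
  shows "1 / (M + (x + y) / 3) \<le> 1 / (M + x) + 1 / (M + y) - 1 / (M + x + y)"
proof -
  \<comment> \<open>Convexity of \<open>1 / z\<close>: replacing \<open>x\<close> and
    \<open>y\<close> by their mean leaves an inequality in \<open>d = x + y\<close> alone.\<close>
  have "4 / ((M + x) + (M + y)) \<le> 1 / (M + x) + 1 / (M + y)"
  proof -
    have "4 * ((M + x) * (M + y)) \<le> ((M + y) + (M + x)) * ((M + x) + (M + y))"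
      using sum_squares_bound[of x y] by (simp add: algebra_simps power2_eq_square)
    moreover have "M + x > 0" "M + y > 0" "(M + x) + (M + y) > 0" using assms by auto
    ultimately show ?thesis
      by (simp only: add_frac_eq pos_divide_le_eq pos_le_divide_eq times_divide_eq_left less_imp_neq[symmetric]
          mult_pos_pos mult_1 simp_thms)
  qed
  moreover have "1 / (M + d / 3) \<le> 4 / (2 * M + d) - 1 / (M + d)" if "d \<ge> 0" for d
  proof -
    have pos: "2 * M + d > 0" "M + d > 0" "3 * M + d > 0" using that assms by auto
    have "(2 * M + 3 * d) * (3 * M + d) - 3 * ((2 * M + d) * (M + d)) = 2 * (M * d)"
      by (simp add: algebra_simps)
    moreover have "0 \<le> M * d" using that assms by simp
    ultimately have le: "3 * ((2 * M + d) * (M + d)) \<le> (2 * M + 3 * d) * (3 * M + d)"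
      by linarith
    have "1 / (M + d / 3) = 3 / (3 * M + d)" by (simp add: field_simps)
    also have "\<dots> \<le> (2 * M + 3 * d) / ((2 * M + d) * (M + d))"
      using le pos by (simp only: pos_divide_le_eq pos_le_divide_eq times_divide_eq_left mult_pos_pos)
    also have "\<dots> = 4 / (2 * M + d) - 1 / (M + d)"
      using pos diff_frac_eq[of "2 * M + d" "M + d" 4 1] by (simp add: algebra_simps)
    finally show ?thesis .
  qed
  from this[of "x + y"] have "1 / (M + (x + y) / 3) \<le> 4 / (2 * M + (x + y)) - 1 / (M + (x + y))"
    using assms by simp
  ultimately show ?thesis by (simp add: algebra_simps)
qed

text \<open>Damping by the factor \<open>l\<close> keeps the geometric series uniformly convergent as \<open>q1\<close>, \<open>q2\<close>
  approach 1.\<close>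

lemma truncated_geometric_bound:
  fixes q1 q2 q3 l s :: real
  assumes q: "0 \<le> q3" "q3 \<le> q1" "q3 \<le> q2" "q1 + q2 - q3 \<le> 1" and l: "0 < l" "l < 1"
  shows "2 * s - s\<^sup>2 * ((1 - l) + (1 - 2 / 3 * (q1 + q2) + q3 / 3)) - 2 * l ^ m / (1 - l)
    \<le> (\<Sum>i<m. q1 ^ i + q2 ^ i - q3 ^ i)"
proof -
  define D where "D = 1 - 2 / 3 * (q1 + q2) + q3 / 3"
  have q1: "q1 \<le> 1" "q2 \<le> 1" "0 \<le> q1" "0 \<le> q2" using q by linarith+
  have le: "l * q \<le> l" if "q \<le> 1" for q using mult_left_mono[of q 1 l] that l by simp
  \<comment> \<open>With \<open>x = l * (q2 - q3)\<close> and \<open>y = l * (q1 - q3)\<close>, the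
    damped densities of single in- and out-neighbours, the denominators \<open>1 - l * q1\<close>,
    \<open>1 - l * q2\<close>, \<open>1 - l * q3\<close> become \<open>M + x\<close>,
    \<open>M + y\<close>, \<open>M + x + y\<close>. Damping keeps \<open>M\<close> at least
    \<open>1 - l\<close>, hence positive.\<close>
  define M where "M = 1 - l * (q1 + q2 - q3)"
  have M: "M \<ge> 1 - l" using le[of "q1 + q2 - q3"] q by (simp add: M_def)
  have geo: "(\<Sum>i<m. (l * q) ^ i) = 1 / (1 - l * q) - (l * q) ^ m / (1 - l * q)" if "q \<le> 1" for q
  proof -
    have "l * q < 1" using le[OF that] l by linarith
    then show ?thesis using sum_gp_strict[of "l * q" m] by (simp add: diff_divide_distrib)
  qed
  have tail: "(l * q) ^ m / (1 - l * q) \<le> l ^ m / (1 - l)" if "0 \<le> q" "q \<le> 1" for q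
    using le[OF that(2)] l that by (intro frac_le power_mono) auto
  have D0: "0 \<le> D" using q q1 by (simp add: D_def field_simps)
  have D: "0 < (1 - l) + l * D"
  proof -
    show ?thesis using l D0 by (simp add: add_pos_nonneg)
  qed
  \<comment> \<open>The tangent to \<open>1 / E\<close> at \<open>E = 1 / s\<close>. It is linear in
    \<open>E\<close>, so that summing it over all vertices later takes the place of Jensen's
    inequality.\<close>
  have tangent: "2 * s - s\<^sup>2 * E \<le> 1 / E" if "E > 0" for E
  proof -
    have "(2 * s - s\<^sup>2 * E) * E = 1 - (s * E - 1)\<^sup>2"
      by (simp add: algebra_simps power2_eq_square)
    also have "\<dots> \<le> 1" by simp
    finally show ?thesis using that by (simp only: pos_le_divide_eq)
  qed
  note tangent[OF D]
  moreover have "l * D \<le> D" using mult_right_mono[of l 1 D] l D0 by simp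
  then have "s\<^sup>2 * ((1 - l) + l * D) \<le> s\<^sup>2 * ((1 - l) + D)" by (intro mult_left_mono) auto
  moreover have "(1 - l) + l * D = M + (l * (q2 - q3) + l * (q1 - q3)) / 3"
    by (simp add: D_def M_def field_simps)
  moreover have "1 / (M + (l * (q2 - q3) + l * (q1 - q3)) / 3) \<le>
      1 / (M + l * (q2 - q3)) + 1 / (M + l * (q1 - q3)) - 1 / (M + l * (q2 - q3) + l * (q1 - q3))"
    using M l q by (intro inverse_sum_bound) auto
  moreover have "M + l * (q2 - q3) = 1 - l * q1" "M + l * (q1 - q3) = 1 - l * q2"
    "1 - l * q1 + l * (q1 - q3) = 1 - l * q3"
    by (simp_all add: M_def algebra_simps)
  \<comment> \<open>The series in \<open>q3\<close> is subtracted, so its tail has a favourable sign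
    and is dropped; only the tails of \<open>q1\<close> and \<open>q2\<close> are paid for.\<close>
  moreover have "0 \<le> (l * q3) ^ m / (1 - l * q3)"
    using q q1 l le[of q3] by (intro divide_nonneg_nonneg zero_le_power mult_nonneg_nonneg) linarith+
  \<comment> \<open>The damped term is \<open>l ^ i\<close> times the undamped one, which is
    nonnegative because \<open>q3\<close> is at most \<open>q1\<close>; so removing the damping can
    only increase the sum.\<close>
  moreover have "(\<Sum>i<m. (l * q1) ^ i) + (\<Sum>i<m. (l * q2) ^ i) - (\<Sum>i<m. (l * q3) ^ i)
      \<le> (\<Sum>i<m. q1 ^ i + q2 ^ i - q3 ^ i)"
    unfolding sum.distrib[symmetric] sum_subtractf[symmetric]
  proof (rule sum_mono)
    fix i
    have "q3 ^ i \<le> q1 ^ i" using q by (intro power_mono) auto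
    moreover have "0 \<le> q2 ^ i" using q1 by simp
    ultimately have "0 \<le> q1 ^ i + q2 ^ i - q3 ^ i" by linarith
    moreover have "l ^ i \<le> 1" using l by (simp add: power_le_one)
    ultimately have "l ^ i * (q1 ^ i + q2 ^ i - q3 ^ i) \<le> 1 * (q1 ^ i + q2 ^ i - q3 ^ i)"
      by (intro mult_right_mono) auto
    then show "(l * q1) ^ i + (l * q2) ^ i - (l * q3) ^ i \<le> q1 ^ i + q2 ^ i - q3 ^ i"
      by (simp add: power_mult_distrib algebra_simps)
  qed
  ultimately show ?thesis
    using geo[of q1] geo[of q2] geo[of q3] tail[of q1] tail[of q2] q q1 
    unfolding D_def[symmetric] by simp
qed

section \<open>Counting samples with prescribed values\<close>

lemma card_PiE_prefix:
  fixes V B :: "'a set"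
  assumes "finite V" "i < m" "v \<in> V" "B \<subseteq> V"
  shows "card {\<phi> \<in> {..<m} \<rightarrow>\<^sub>E V. \<phi> i = v \<and> (\<forall>j<i. \<phi> j \<in> B)} = card B ^ i * card V ^ (m - 1 - i)"
proof -
  let ?F = "\<lambda>j. if j < i then B else if j = i then {v} else V"
  have "{\<phi> \<in> {..<m} \<rightarrow>\<^sub>E V. \<phi> i = v \<and> (\<forall>j<i. \<phi> j \<in> B)} = PiE {..<m} ?F"
    using assms by (fastforce simp: PiE_iff split: if_splits)
  then have "card {\<phi> \<in> {..<m} \<rightarrow>\<^sub>E V. \<phi> i = v \<and> (\<forall>j<i. \<phi> j \<in> B)} = (\<Prod>j<m. card (?F j))"
    by (simp add: card_PiE)
  also have "\<dots> = (\<Prod>j\<in>{..<i} \<union> ({i} \<union> {i<..<m}). card (?F j))"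
    by (rule prod.cong) (use assms(2) in auto)
  also have "\<dots> = (\<Prod>j<i. card (?F j)) * (\<Prod>j\<in>{i} \<union> {i<..<m}. card (?F j))"
    by (rule prod.union_disjoint) auto
  also have "(\<Prod>j\<in>{i} \<union> {i<..<m}. card (?F j)) = (\<Prod>j\<in>{i<..<m}. card (?F j))"
    by (subst prod.union_disjoint) auto
  also have "(\<Prod>j<i. card (?F j)) = card B ^ i" by simp
  also have "(\<Prod>j\<in>{i<..<m}. card (?F j)) = card V ^ (m - 1 - i)"
    by (subst prod.cong[where h = "\<lambda>_. card V", OF refl]) auto
  finally show ?thesis .
qed

text \<open>Such a sample is determined by its restriction to the indices outside \<open>is\<close>.
  This is only an upper bound, since \<open>ys\<close> may have the wrong length or leave
  \<open>V\<close>.\<close>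

lemma card_PiE_fibre_le:
  assumes "finite V" "distinct is" "set is \<subseteq> {..<m}"
  shows "card {\<phi> \<in> {..<m} \<rightarrow>\<^sub>E V. map \<phi> is = ys} \<le> card V ^ (m - length is)"
proof -
  let ?J = "{..<m} - set is"
  let ?P = "{\<phi> \<in> {..<m} \<rightarrow>\<^sub>E V. map \<phi> is = ys}"
  have "inj_on (\<lambda>\<phi>. restrict \<phi> ?J) ?P"
  proof (rule inj_onI)
    fix \<phi> \<psi> assume \<phi>: "\<phi> \<in> ?P" and \<psi>: "\<psi> \<in> ?P" and eq: "restrict \<phi> ?J = restrict \<psi> ?J"
    have "map \<phi> is = ys" "map \<psi> is = ys" using \<phi> \<psi> by blast+
    then have "map \<phi> is = map \<psi> is" by (rule trans[OF _ sym])
    then have "\<forall>j\<in>set is. \<phi> j = \<psi> j" by (simp only: map_eq_conv)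
    moreover have "\<forall>j\<in>?J. \<phi> j = \<psi> j" using eq by (metis restrict_apply')
    moreover have "\<phi> \<in> {..<m} \<rightarrow>\<^sub>E V" "\<psi> \<in> {..<m} \<rightarrow>\<^sub>E V" using \<phi> \<psi> by blast+
    ultimately show "\<phi> = \<psi>" by (intro PiE_ext[of \<phi> "{..<m}" "\<lambda>_. V" \<psi>]) blast+
  qed
  moreover have "(\<lambda>\<phi>. restrict \<phi> ?J) ` ?P \<subseteq> ?J \<rightarrow>\<^sub>E V" by (auto simp: PiE_iff split: if_splits)
  moreover have "finite (?J \<rightarrow>\<^sub>E V)" using assms(1) by (intro finite_PiE) auto
  ultimately have "card ?P \<le> card (?J \<rightarrow>\<^sub>E V)" by (rule card_inj_on_le)
  also have "\<dots> = card V ^ card ?J" using assms(1) by (simp add: card_PiE)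
  also have "card ?J = m - length is"
    using assms by (simp add: card_Diff_subset distinct_card)
  finally show ?thesis .
qed

section \<open>Kept indices of a sample and transitive tournaments\<close>

text \<open>Samples may repeat vertices. If \<open>A\<close> has no loops, an index whose vertex
  occurred earlier is discarded automatically. Index 0 is always kept when \<open>m > 0\<close>,
  both conditions being vacuous.\<close>

definition dominating_indices :: "('a \<times> 'a) set \<Rightarrow> nat \<Rightarrow> (nat \<Rightarrow> 'a) \<Rightarrow> nat set" where
  "dominating_indices A m \<phi> =
     {i. i < m \<and> ((\<forall>j<i. (\<phi> i, \<phi> j) \<in> A) \<or> (\<forall>j<i. (\<phi> j, \<phi> i) \<in> A))}"

text \<open>Ordered, not necessarily induced copies of the transitive tournament on \<open>k\<close>
  vertices; entries are distinct when \<open>A\<close> has no loops. In lists, position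
  \<open>i\<close> can later play the role of class \<open>i\<close> of the blow-up.\<close>

definition transitive_lists :: "'a set \<Rightarrow> ('a \<times> 'a) set \<Rightarrow> nat \<Rightarrow> 'a list set" where
  "transitive_lists V A k =
     {ys. set ys \<subseteq> V \<and> length ys = k \<and> sorted_wrt (\<lambda>u v. (u, v) \<in> A) ys}"

lemma finite_transitive_lists: "finite V \<Longrightarrow> finite (transitive_lists V A k)"
  by (rule finite_subset[OF _ finite_lists_length_eq[of V k]]) (auto simp: transitive_lists_def)

text \<open>The list follows the tournament order, not the sampling order: a kept index is
  comparable in one direction with all earlier indices, so it extends the list at one end.\<close>

lemma dominating_indices_transitive:
  "\<exists>xs. set xs = dominating_indices A m \<phi> \<and> distinct xs \<and> sorted_wrt (\<lambda>i j. (\<phi> i, \<phi> j) \<in> A) xs"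
proof (induction m)
  case (Suc m)
  then obtain xs where xs: "set xs = dominating_indices A m \<phi>" "distinct xs"
    "sorted_wrt (\<lambda>i j. (\<phi> i, \<phi> j) \<in> A) xs" by blast
  have lt: "\<forall>i\<in>set xs. i < m" using xs(1) by (simp add: dominating_indices_def)
  consider (top) "\<forall>j<m. (\<phi> m, \<phi> j) \<in> A" | (bottom) "\<forall>j<m. (\<phi> j, \<phi> m) \<in> A"
    | (none) "m \<notin> dominating_indices A (Suc m) \<phi>"
    by (auto simp: dominating_indices_def)
  then show ?case
  proof cases
    case top
    then have "set (m # xs) = dominating_indices A (Suc m) \<phi>"
      using xs(1) by (auto simp: dominating_indices_def less_Suc_eq)
    moreover have "sorted_wrt (\<lambda>i j. (\<phi> i, \<phi> j) \<in> A) (m # xs)" using top xs(3) lt by simp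
    moreover have "distinct (m # xs)" using lt xs(2) by auto
    ultimately show ?thesis by blast
  next
    case bottom
    then have "set (xs @ [m]) = dominating_indices A (Suc m) \<phi>"
      using xs(1) by (auto simp: dominating_indices_def less_Suc_eq)
    moreover have "sorted_wrt (\<lambda>i j. (\<phi> i, \<phi> j) \<in> A) (xs @ [m])"
      using bottom xs(3) lt by (simp add: sorted_wrt_append)
    moreover have "distinct (xs @ [m])" using lt xs(2) by auto
    ultimately show ?thesis by blast
  next
    case none
    then have "dominating_indices A (Suc m) \<phi> = dominating_indices A m \<phi>"
      by (auto simp: dominating_indices_def less_Suc_eq)
    then show ?thesis using xs by auto
  qed
qed (auto simp: dominating_indices_def)

text \<open>If more than \<open>r\<close> indices are kept, the first \<open>Suc r\<close> entries
  of their tournament order form at least one good index list, and the trivial bound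
  \<open>m\<close> on the number of kept indices suffices.\<close>

lemma card_dominating_indices_le:
  assumes "\<phi> \<in> {..<m} \<rightarrow>\<^sub>E V"
  shows "card (dominating_indices A m \<phi>) \<le>
    r + m * card {is. set is \<subseteq> {..<m} \<and> length is = Suc r \<and> distinct is \<and>
      map \<phi> is \<in> transitive_lists V A (Suc r)}" (is "_ \<le> r + m * card ?I")
proof (cases "card (dominating_indices A m \<phi>) \<le> r")
  case False
  obtain xs where xs: "set xs = dominating_indices A m \<phi>" "distinct xs"
    "sorted_wrt (\<lambda>i j. (\<phi> i, \<phi> j) \<in> A) xs" using dominating_indices_transitive by blast
  have sub: "dominating_indices A m \<phi> \<subseteq> {..<m}" by (auto simp: dominating_indices_def)
  have len: "length xs \<ge> Suc r" using False xs distinct_card[of xs] by simp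
  let ?is = "take (Suc r) xs"
  have "set ?is \<subseteq> {..<m}" using xs(1) sub set_take_subset[of "Suc r" xs] by auto
  moreover have "\<phi> ` {..<m} \<subseteq> V" using assms by auto
  ultimately have "set (map \<phi> ?is) \<subseteq> V" by auto
  moreover have "sorted_wrt (\<lambda>u v. (u, v) \<in> A) (map \<phi> ?is)"
    using xs(3) by (simp add: sorted_wrt_map sorted_wrt_take)
  ultimately have "?is \<in> ?I"
    using \<open>set ?is \<subseteq> {..<m}\<close> len xs(2) by (simp add: transitive_lists_def)
  moreover have "finite ?I"
    by (rule finite_subset[OF _ finite_lists_length_eq[of "{..<m}" "Suc r"]]) auto
  ultimately have "card {?is} \<le> card ?I" by (intro card_mono) (simp_all only: insert_subset empty_subsetI simp_thms)
  then have "m * 1 \<le> m * card ?I" by (intro mult_left_mono) simp_all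
  then have "m \<le> m * card ?I" by (simp only: mult_1_right)
  moreover have "card (dominating_indices A m \<phi>) \<le> m" using card_mono[OF _ sub] by simp
  ultimately show ?thesis by linarith
qed simp

text \<open>Double counting of pairs of a sample and a good index list: there are at most
  \<open>m ^ Suc r\<close> index lists, and each is mapped onto a given tournament by at most
  \<open>card V ^ (m - Suc r)\<close> samples.\<close>

lemma sum_card_dominating_indices_le:
  assumes V: "finite V"
  shows "(\<Sum>\<phi>\<in>{..<m} \<rightarrow>\<^sub>E V. card (dominating_indices A m \<phi>)) \<le>
    r * card V ^ m + m * (m ^ Suc r * (card (transitive_lists V A (Suc r)) * card V ^ (m - Suc r)))"
proof -
  let ?\<Phi> = "{..<m} \<rightarrow>\<^sub>E V"
  let ?S = "transitive_lists V A (Suc r)"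
  define I where "I = {is. set is \<subseteq> {..<m} \<and> length is = Suc r \<and> distinct is}"
  have finI: "finite I" and cardI: "card I \<le> m ^ Suc r"
  proof -
    have *: "I \<subseteq> {is. set is \<subseteq> {..<m} \<and> length is = Suc r}" by (auto simp: I_def)
    show "finite I" by (rule finite_subset[OF * finite_lists_length_eq]) simp
    show "card I \<le> m ^ Suc r"
      using card_mono[OF finite_lists_length_eq *] card_lists_length_eq[of "{..<m}" "Suc r"] by simp
  qed
  have fin: "finite ?\<Phi>" using V by (intro finite_PiE) auto
  have "(\<Sum>\<phi>\<in>?\<Phi>. card (dominating_indices A m \<phi>)) \<le> (\<Sum>\<phi>\<in>?\<Phi>. r + m * card {is \<in> I. map \<phi> is \<in> ?S})"
    using card_dominating_indices_le[of _ m V A r]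
    by (intro sum_mono) (simp add: I_def conj_assoc)
  also have "\<dots> = r * card V ^ m + m * (\<Sum>\<phi>\<in>?\<Phi>. card {is \<in> I. map \<phi> is \<in> ?S})"
    using V by (simp add: sum.distrib sum_distrib_left card_PiE)
  also have "(\<Sum>\<phi>\<in>?\<Phi>. card {is \<in> I. map \<phi> is \<in> ?S}) = (\<Sum>is\<in>I. card {\<phi> \<in> ?\<Phi>. map \<phi> is \<in> ?S})"
  proof -
    have "(\<Sum>\<phi>\<in>?\<Phi>. card {is \<in> I. map \<phi> is \<in> ?S}) = (\<Sum>\<phi>\<in>?\<Phi>. \<Sum>is\<in>I. if map \<phi> is \<in> ?S then 1 else 0)"
      using finI by (simp add: sum.If_cases Int_def)
    also have "\<dots> = (\<Sum>is\<in>I. \<Sum>\<phi>\<in>?\<Phi>. if map \<phi> is \<in> ?S then 1 else 0)" by (rule sum.swap)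
    finally show ?thesis using fin by (simp add: sum.If_cases Int_def)
  qed
  also have "\<dots> \<le> (\<Sum>is\<in>I. card ?S * card V ^ (m - Suc r))"
  proof (rule sum_mono)
    fix is' assume "is' \<in> I"
    then have is': "set is' \<subseteq> {..<m}" "length is' = Suc r" "distinct is'" by (auto simp: I_def)
    have un: "{\<phi> \<in> ?\<Phi>. map \<phi> is' \<in> ?S} = (\<Union>ys\<in>?S. {\<phi> \<in> ?\<Phi>. map \<phi> is' = ys})" by blast
    have "card {\<phi> \<in> ?\<Phi>. map \<phi> is' \<in> ?S} \<le> (\<Sum>ys\<in>?S. card {\<phi> \<in> ?\<Phi>. map \<phi> is' = ys})"
      unfolding un by (rule card_UN_le[OF finite_transitive_lists[OF V]])
    also have "\<dots> \<le> (\<Sum>ys\<in>?S. card V ^ (m - Suc r))"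
      using card_PiE_fibre_le[OF V is'(3,1)] unfolding is'(2) by (intro sum_mono)
    finally show "card {\<phi> \<in> ?\<Phi>. map \<phi> is' \<in> ?S} \<le> card ?S * card V ^ (m - Suc r)" by simp
  qed
  also have "\<dots> = card I * (card ?S * card V ^ (m - Suc r))" by simp
  also have "\<dots> \<le> m ^ Suc r * (card ?S * card V ^ (m - Suc r))"
    by (rule mult_right_mono[OF cardI]) simp
  finally show ?thesis by (simp add: mult_left_mono)
qed

text \<open>Linearity of expectation over \<open>i\<close> and the vertex \<open>v\<close> at index
  \<open>i\<close>. The factor \<open>n ^ m / n\<close> is the number of samples with
  \<open>\<phi> i = v\<close>; the rest is inclusion-exclusion over all earlier vertices being
  out-neighbours or all being in-neighbours of \<open>v\<close>.\<close>

lemma sum_card_dominating_indices_eq: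
  assumes V: "finite V" "A \<subseteq> V \<times> V" and n: "n = real (card V)" "n > 0"
  shows "real (\<Sum>\<phi>\<in>{..<m} \<rightarrow>\<^sub>E V. card (dominating_indices A m \<phi>)) =
    n ^ m / n * (\<Sum>v\<in>V. \<Sum>i<m. (card {u. (v, u) \<in> A} / n) ^ i + (card {u. (u, v) \<in> A} / n) ^ i
      - (card {u. (v, u) \<in> A \<and> (u, v) \<in> A} / n) ^ i)"
proof -
  let ?\<Phi> = "{..<m} \<rightarrow>\<^sub>E V"
  let ?P = "\<lambda>i \<phi>. (\<forall>j<i. (\<phi> i, \<phi> j) \<in> A) \<or> (\<forall>j<i. (\<phi> j, \<phi> i) \<in> A)"
  let ?d = "\<lambda>v i. (card {u. (v, u) \<in> A} / n) ^ i + (card {u. (u, v) \<in> A} / n) ^ i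
      - (card {u. (v, u) \<in> A \<and> (u, v) \<in> A} / n) ^ i"
  have fin: "finite ?\<Phi>" using V by (intro finite_PiE) auto
  have prefix: "real (card {\<phi> \<in> ?\<Phi>. \<phi> i = v \<and> (\<forall>j<i. \<phi> j \<in> B)}) = n ^ m / n * (card B / n) ^ i"
    if "i < m" "v \<in> V" "B \<subseteq> V" for i v B
  proof -
    have "m = i + (m - 1 - i) + 1" using that(1) by simp
    then have "n ^ m = n ^ i * n ^ (m - 1 - i) * n" by (metis power_add power_one_right)
    then have "n ^ m / n * (card B / n) ^ i = real (card B) ^ i * n ^ (m - 1 - i)"
      using n(2) by (simp add: power_divide)
    then show ?thesis by (simp add: card_PiE_prefix[OF V(1) that] n(1))
  qed
  have point: "real (card {\<phi> \<in> ?\<Phi>. \<phi> i = v \<and> ?P i \<phi>}) = n ^ m / n * ?d v i" if "i < m" "v \<in> V" for i v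
  proof -
    let ?X = "{\<phi> \<in> ?\<Phi>. \<phi> i = v \<and> (\<forall>j<i. \<phi> j \<in> {u. (v, u) \<in> A})}"
    let ?Y = "{\<phi> \<in> ?\<Phi>. \<phi> i = v \<and> (\<forall>j<i. \<phi> j \<in> {u. (u, v) \<in> A})}"
    have un: "{\<phi> \<in> ?\<Phi>. \<phi> i = v \<and> ?P i \<phi>} = ?X \<union> ?Y" by auto
    have int: "?X \<inter> ?Y = {\<phi> \<in> ?\<Phi>. \<phi> i = v \<and> (\<forall>j<i. \<phi> j \<in> {u. (v, u) \<in> A \<and> (u, v) \<in> A})}" by auto
    have "card ?X + card ?Y = card (?X \<union> ?Y) + card (?X \<inter> ?Y)"
      by (rule card_Un_Int) (use fin in auto)
    then have "real (card (?X \<union> ?Y)) = real (card ?X) + real (card ?Y) - real (card (?X \<inter> ?Y))"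
      by linarith
    moreover have "{u. (v, u) \<in> A} \<subseteq> V" "{u. (u, v) \<in> A} \<subseteq> V" "{u. (v, u) \<in> A \<and> (u, v) \<in> A} \<subseteq> V"
      using V(2) by auto
    ultimately show ?thesis
      unfolding un int by (simp only: prefix[OF that] distrib_left right_diff_distrib)
  qed
  have "(\<Sum>\<phi>\<in>?\<Phi>. card (dominating_indices A m \<phi>)) = (\<Sum>\<phi>\<in>?\<Phi>. \<Sum>i<m. if ?P i \<phi> then 1 else 0)"
    by (rule sum.cong[OF refl]) (simp add: dominating_indices_def sum.If_cases Int_def)
  also have "\<dots> = (\<Sum>i<m. \<Sum>\<phi>\<in>?\<Phi>. if ?P i \<phi> then 1 else 0)" by (rule sum.swap)
  also have "\<dots> = (\<Sum>i<m. card {\<phi> \<in> ?\<Phi>. ?P i \<phi>})"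
    using fin by (simp add: sum.If_cases Int_def)
  also have "\<dots> = (\<Sum>i<m. \<Sum>v\<in>V. card {\<phi> \<in> ?\<Phi>. \<phi> i = v \<and> ?P i \<phi>})"
  proof (rule sum.cong[OF refl])
    fix i assume "i \<in> {..<m}"
    then have "(\<lambda>\<phi>. \<phi> i) ` {\<phi> \<in> ?\<Phi>. ?P i \<phi>} \<subseteq> V" by auto
    moreover have "finite {\<phi> \<in> ?\<Phi>. ?P i \<phi>}" using fin by simp
    ultimately have "(\<Sum>v\<in>V. \<Sum>\<phi>\<in>{\<phi> \<in> {\<phi> \<in> ?\<Phi>. ?P i \<phi>}. \<phi> i = v}. 1) = (\<Sum>\<phi>\<in>{\<phi> \<in> ?\<Phi>. ?P i \<phi>}. 1::nat)"
      by (intro sum.group) (use V in auto)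
    moreover have "{\<phi> \<in> {\<phi> \<in> ?\<Phi>. ?P i \<phi>}. \<phi> i = v} = {\<phi> \<in> ?\<Phi>. \<phi> i = v \<and> ?P i \<phi>}" for v by blast
    ultimately show "card {\<phi> \<in> ?\<Phi>. ?P i \<phi>} = (\<Sum>v\<in>V. card {\<phi> \<in> ?\<Phi>. \<phi> i = v \<and> ?P i \<phi>})"
      by (simp only: card_eq_sum)
  qed
  finally have "real (\<Sum>\<phi>\<in>?\<Phi>. card (dominating_indices A m \<phi>)) =
      (\<Sum>i<m. \<Sum>v\<in>V. real (card {\<phi> \<in> ?\<Phi>. \<phi> i = v \<and> ?P i \<phi>}))" by simp
  also have "\<dots> = (\<Sum>i<m. \<Sum>v\<in>V. n ^ m / n * ?d v i)"
    by (intro sum.cong refl point) auto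
  also have "\<dots> = (\<Sum>v\<in>V. \<Sum>i<m. n ^ m / n * ?d v i)" by (rule sum.swap)
  finally show ?thesis by (simp only: sum_distrib_left)
qed

section \<open>Supersaturation: a positive density of transitive tournaments\<close>

text \<open>The weight in the hypothesis is \<open>2 / a * e_a a A\<close> at
  \<open>a = 3/2\<close>. It is what \<open>n^2\<close> minus \<open>n\<close> times the sum of
  \<open>\<delta>\<close> amounts to. Comparing the lower and upper bounds for the total number of
  kept indices gives the claim.\<close>

lemma many_transitive_lists:
  fixes \<gamma> :: real
  assumes r: "r \<ge> 1" and \<gamma>: "\<gamma> > 0"
  shows "\<exists>c>0. \<exists>N. \<forall>(V :: 'a set) A. digraph V A \<and> card V \<ge> N \<and>
    2 * real (f2 A) + 4 / 3 * real (f1 A) \<ge> (1 - 1 / real r + \<gamma>) * (real (card V))\<^sup>2 - real r \<longrightarrow>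
    real (card (transitive_lists V A (Suc r))) \<ge> c * real (card V) ^ Suc r"
proof -
  \<comment> \<open>The damping factor is \<open>1 - \<epsilon>\<close>. Averaging will gain
    \<open>3 * \<eta>\<close> over \<open>R\<close>; the damping and the truncation at
    \<open>m\<close> cost at most \<open>\<eta>\<close> each, which leaves a surplus of
    \<open>\<eta>\<close>.\<close>
  define \<epsilon> where "\<epsilon> = min (1 / 2) (\<gamma> / 4)"
  have \<epsilon>: "0 < \<epsilon>" "\<epsilon> < 1" "\<epsilon> \<le> \<gamma> / 4" using \<gamma> by (auto simp: \<epsilon>_def)
  define R where "R = real r"
  have R: "R \<ge> 1" using r by (simp add: R_def)
  define \<eta> where "\<eta> = R\<^sup>2 * \<gamma> / 4"
  have \<eta>: "\<eta> > 0" using R \<gamma> by (simp add: \<eta>_def)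
  have "\<eta> * \<epsilon> / 2 > 0" using \<eta> \<epsilon> by simp
  from real_arch_pow_inv[OF this, of "1 - \<epsilon>"] \<epsilon> obtain m0 where m0: "(1 - \<epsilon>) ^ m0 < \<eta> * \<epsilon> / 2" by auto
  define m where "m = max m0 (Suc r)"
  have "(1 - \<epsilon>) ^ m \<le> (1 - \<epsilon>) ^ m0" using \<epsilon> by (intro power_decreasing) (auto simp: m_def)
  then have tail: "2 * (1 - \<epsilon>) ^ m / \<epsilon> \<le> \<eta>" 
  proof -
    have "2 * (1 - \<epsilon>) ^ m \<le> \<eta> * \<epsilon>" using m0 \<open>(1 - \<epsilon>) ^ m \<le> _\<close> by linarith
    then show ?thesis using \<epsilon>(1) by (simp only: pos_divide_le_eq)
  qed
  have m: "m \<ge> Suc r" by (simp add: m_def)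
  define K where "K = real m * real m ^ Suc r"
  have K: "K > 0" using m by (simp add: K_def)
  \<comment> \<open>Large enough for \<open>\<gamma> / 4 * n^2\<close> to absorb the additive error
    \<open>real r\<close>.\<close>
  obtain N where N: "real N > 4 * R / \<gamma>" using reals_Archimedean2 by blast
  show ?thesis
  proof (intro exI[of _ "\<eta> / K"] conjI exI[of _ "Suc N"] allI impI)
    show "\<eta> / K > 0" using \<eta> K by simp
    fix V :: "'a set" and A
    assume *: "digraph V A \<and> card V \<ge> Suc N \<and>
      2 * real (f2 A) + 4 / 3 * real (f1 A) \<ge> (1 - 1 / real r + \<gamma>) * (real (card V))\<^sup>2 - real r"
    then have V: "finite V" "A \<subseteq> V \<times> V" "\<forall>v. (v, v) \<notin> A" by (auto simp: digraph_def)
    have finA: "finite A" by (rule finite_subset[OF V(2)]) (use V(1) in simp)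
    define n where "n = real (card V)"
    have n1: "n \<ge> 1" and nN: "n \<ge> real N" using * by (simp_all add: n_def)
    have "4 * R / \<gamma> \<le> n\<^sup>2"
    proof -
      have "4 * R / \<gamma> \<le> n * 1" using N nN by simp
      also have "\<dots> \<le> n * n" using n1 by (intro mult_left_mono) auto
      finally show ?thesis by (simp add: power2_eq_square)
    qed
    then have nR: "R \<le> \<gamma> / 4 * n\<^sup>2" using \<gamma> by (simp add: field_simps)
    define q1 q2 q3 where "q1 = (\<lambda>v. card {u. (v, u) \<in> A} / n)"
      and "q2 = (\<lambda>v. card {u. (u, v) \<in> A} / n)"
      and "q3 = (\<lambda>v. card {u. (v, u) \<in> A \<and> (u, v) \<in> A} / n)"
    define \<delta> where "\<delta> = (\<lambda>v. 1 - 2 / 3 * (q1 v + q2 v) + q3 v / 3)"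
    \<comment> \<open>Used with \<open>s = R\<close>: the tangent is taken at \<open>1 / R\<close>,
      the value below which the average of \<open>\<delta>\<close> will be shown to lie.\<close>
    have vertex: "2 * R - R\<^sup>2 * (\<epsilon> + \<delta> v) - \<eta> \<le> (\<Sum>i<m. q1 v ^ i + q2 v ^ i - q3 v ^ i)" for v
    proof -
      let ?X = "{u. (v, u) \<in> A}" and ?Y = "{u. (u, v) \<in> A}"
      have sub: "?X \<subseteq> V" "?Y \<subseteq> V" using V(2) by auto
      have fin: "finite ?X" "finite ?Y" using sub V(1) by (auto intro: finite_subset)
      have int: "{u. (v, u) \<in> A \<and> (u, v) \<in> A} = ?X \<inter> ?Y" by auto
      have "card ?X + card ?Y = card (?X \<union> ?Y) + card (?X \<inter> ?Y)" by (rule card_Un_Int[OF fin])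
      moreover have "card (?X \<union> ?Y) \<le> card V" using sub V(1) by (intro card_mono) auto
      ultimately have "real (card ?X) + real (card ?Y) - real (card (?X \<inter> ?Y)) \<le> n"
        by (simp add: n_def)
      then have "q1 v + q2 v - q3 v \<le> 1"
        using n1 unfolding q1_def q2_def q3_def int
        by (simp add: add_divide_distrib[symmetric] diff_divide_distrib[symmetric])
      moreover have "q3 v \<le> q1 v" "q3 v \<le> q2 v" "0 \<le> q3 v"
        unfolding q1_def q2_def q3_def int using n1 fin
        by (auto intro!: divide_right_mono card_mono)
      ultimately have "2 * R - R\<^sup>2 * ((1 - (1 - \<epsilon>)) + \<delta> v) - 2 * (1 - \<epsilon>) ^ m / (1 - (1 - \<epsilon>))
          \<le> (\<Sum>i<m. q1 v ^ i + q2 v ^ i - q3 v ^ i)"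
        unfolding \<delta>_def using \<epsilon> by (intro truncated_geometric_bound) auto
      then show ?thesis using tail by simp
    qed
    \<comment> \<open>At each of its two ends a single pair lowers \<open>n * \<delta>\<close> by
      \<open>2/3\<close> and a double pair by \<open>4/3 - 1/3 = 1\<close>.\<close>
    have "(\<Sum>v\<in>V. \<delta> v) * n = n\<^sup>2 - (2 * real (f2 A) + 4 / 3 * real (f1 A))"
    proof -
      have "(\<Sum>v\<in>V. real (card {u. (v, u) \<in> A})) = card A"
        using card_arcs_eq_sum_out[OF V(1,2)] by simp
      moreover have "(\<Sum>v\<in>V. real (card {u. (u, v) \<in> A})) = card A"
        using card_arcs_eq_sum_in[OF V(1,2)] by simp
      moreover have "(\<Sum>v\<in>V. real (card {u. (v, u) \<in> A \<and> (u, v) \<in> A})) = card (A \<inter> A\<inverse>)"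
      proof -
        have "A \<inter> A\<inverse> \<subseteq> V \<times> V" using V(2) by auto
        from card_arcs_eq_sum_out[OF V(1) this] show ?thesis by simp
      qed
      moreover have "(\<Sum>v\<in>V. \<delta> v) = n - 2 / 3 * ((\<Sum>v\<in>V. q1 v) + (\<Sum>v\<in>V. q2 v)) + (\<Sum>v\<in>V. q3 v) / 3"
        unfolding \<delta>_def
        by (simp only: sum.distrib sum_subtractf sum_distrib_left[symmetric] sum_divide_distrib[symmetric])
          (simp add: n_def)
      moreover have "card A = f1 A + 2 * f2 A" "card (A \<inter> A\<inverse>) = 2 * f2 A"
        using card_arcs_eq_f1_f2[OF V(3) finA] double_f2_eq_card[OF V(3) finA] by simp_all
      ultimately have "(\<Sum>v\<in>V. \<delta> v) = n - 4 / 3 * ((real (f1 A) + 2 * real (f2 A)) / n) + 2 / 3 * (real (f2 A) / n)"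
        by (simp add: q1_def q2_def q3_def sum_divide_distrib[symmetric])
      then show ?thesis using n1 by (simp add: field_simps power2_eq_square)
    qed
    also have "\<dots> \<le> n\<^sup>2 - ((1 - 1 / R + \<gamma>) * n\<^sup>2 - R)" using * by (simp add: n_def R_def)
    also have "\<dots> = (1 / R - \<gamma>) * n\<^sup>2 + R" by (simp add: algebra_simps)
    also have "\<dots> \<le> (1 / R - \<gamma>) * n\<^sup>2 + \<gamma> / 4 * n\<^sup>2" using nR by simp
    also have "\<dots> = ((1 / R - 3 / 4 * \<gamma>) * n) * n" by (simp add: algebra_simps power2_eq_square)
    finally have \<delta>: "(\<Sum>v\<in>V. \<delta> v) \<le> (1 / R - 3 / 4 * \<gamma>) * n" using n1 by simp
    have "(R + \<eta>) * n \<le> (2 * R - R\<^sup>2 * \<epsilon> - \<eta>) * n - R\<^sup>2 * ((1 / R - 3 / 4 * \<gamma>) * n)"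
    proof -
      have "R\<^sup>2 * (1 / R) = R" using R by (simp add: power2_eq_square)
      then have "R\<^sup>2 * (1 / R - 3 / 4 * \<gamma>) = R - 3 * \<eta>"
        by (simp only: right_diff_distrib \<eta>_def)
      then have "R\<^sup>2 * ((1 / R - 3 / 4 * \<gamma>) * n) = (R - 3 * \<eta>) * n"
        by (simp only: mult.assoc[symmetric])
      moreover have "R\<^sup>2 * \<epsilon> \<le> \<eta>" using mult_left_mono[OF \<epsilon>(3), of "R\<^sup>2"] by (simp add: \<eta>_def)
      then have "(R + \<eta>) * n \<le> ((2 * R - R\<^sup>2 * \<epsilon> - \<eta>) - (R - 3 * \<eta>)) * n"
        using n1 by (intro mult_right_mono) auto
      ultimately show ?thesis by (simp only: left_diff_distrib[of "2 * R - R\<^sup>2 * \<epsilon> - \<eta>" "R - 3 * \<eta>"])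
    qed
    also have "\<dots> \<le> (2 * R - R\<^sup>2 * \<epsilon> - \<eta>) * n - R\<^sup>2 * (\<Sum>v\<in>V. \<delta> v)"
      using mult_left_mono[OF \<delta>, of "R\<^sup>2"] by simp
    also have "\<dots> = (\<Sum>v\<in>V. 2 * R - R\<^sup>2 * (\<epsilon> + \<delta> v) - \<eta>)"
      by (simp only: sum_subtractf sum.distrib sum_distrib_left[symmetric] distrib_left sum_constant)
        (simp add: n_def algebra_simps)
    also have "\<dots> \<le> (\<Sum>v\<in>V. \<Sum>i<m. q1 v ^ i + q2 v ^ i - q3 v ^ i)" by (intro sum_mono vertex)
    finally have "n ^ m / n * ((R + \<eta>) * n) \<le> n ^ m / n * (\<Sum>v\<in>V. \<Sum>i<m. q1 v ^ i + q2 v ^ i - q3 v ^ i)"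
      using n1 by (intro mult_left_mono) auto
    also have "\<dots> = real (\<Sum>\<phi>\<in>{..<m} \<rightarrow>\<^sub>E V. card (dominating_indices A m \<phi>))"
      unfolding q1_def q2_def q3_def
      using sum_card_dominating_indices_eq[OF V(1,2) n_def, of m] n1 by simp
    also have "\<dots> \<le> real (r * card V ^ m + m * (m ^ Suc r * (card (transitive_lists V A (Suc r)) * card V ^ (m - Suc r))))"
      by (rule of_nat_mono[OF sum_card_dominating_indices_le[OF V(1)]])
    also have "\<dots> = R * n ^ m + K * real (card (transitive_lists V A (Suc r))) * n ^ (m - Suc r)"
      by (simp add: R_def n_def K_def)
    finally have "\<eta> * n ^ m \<le> K * real (card (transitive_lists V A (Suc r))) * n ^ (m - Suc r)"
      using n1 by (simp add: distrib_right distrib_left mult.commute)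
    moreover have "n ^ m = n ^ Suc r * n ^ (m - Suc r)" using m by (simp only: power_add[symmetric] le_add_diff_inverse)
    ultimately have "(\<eta> * n ^ Suc r) * n ^ (m - Suc r) \<le> (K * real (card (transitive_lists V A (Suc r)))) * n ^ (m - Suc r)"
      by (simp only: mult.assoc)
    then have "\<eta> * n ^ Suc r \<le> K * real (card (transitive_lists V A (Suc r)))"
      by (rule mult_right_le_imp_le) (use n1 in simp)
    then show "\<eta> / K * real (card V) ^ Suc r \<le> real (card (transitive_lists V A (Suc r)))"
      using K unfolding n_def by (simp only: times_divide_eq_left pos_divide_le_eq mult.commute)
  qed
qed

text \<open>Erdos's theorem on \<open>k\<close>-partite \<open>k\<close>-uniform hypergraphs, with lists as edges.\<close>

lemma dense_lists_contain_box:
  fixes c :: real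
  assumes t: "t \<ge> 1" and "c > 0"
  shows "\<exists>N. \<forall>(V :: 'a set) S. finite V \<and> card V \<ge> N \<and> S \<subseteq> {ys. set ys \<subseteq> V \<and> length ys = k} \<and>
    real (card S) \<ge> c * real (card V) ^ k \<longrightarrow>
    (\<exists>U. (\<forall>i<k. U i \<subseteq> V \<and> card (U i) = t) \<and>
      (\<forall>ys. length ys = k \<and> (\<forall>i<k. ys ! i \<in> U i) \<longrightarrow> ys \<in> S))"
  using assms(2)
\<comment> \<open>\<open>c\<close> must vary, because the density drops to \<open>c'\<close> each
  time a coordinate is removed.\<close>
proof (induction k arbitrary: c)
  case 0
  have "[] \<in> S" if "S \<subseteq> {ys :: 'a list. set ys \<subseteq> V \<and> length ys = 0}" "real (card S) \<ge> c * real (card V) ^ 0"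
    for V S
  proof -
    have "S \<noteq> {}" using that(2) 0 by auto
    then show ?thesis using that(1) by fastforce
  qed
  then show ?case by (intro exI[of _ 0]) auto
next
  case (Suc k)
  \<comment> \<open>At least \<open>c / 2 * n ^ k\<close> tails have \<open>c / 2 * n\<close> or
    more extensions, each such tail admits at least \<open>(c * n / (2 * t)) ^ t\<close> sets of
    \<open>t\<close> extensions, and there are at most \<open>n ^ t\<close> sets of size
    \<open>t\<close> in all.\<close>
  define c' where "c' = c / 2 * (c / (2 * real t)) ^ t"
  have c': "c' > 0" using Suc.prems t by (simp add: c'_def)
  from Suc.IH[OF this] obtain N1 where N1: "\<forall>(V :: 'a set) S. finite V \<and> card V \<ge> N1 \<and>
    S \<subseteq> {ys. set ys \<subseteq> V \<and> length ys = k} \<and> real (card S) \<ge> c' * real (card V) ^ k \<longrightarrow>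
    (\<exists>U. (\<forall>i<k. U i \<subseteq> V \<and> card (U i) = t) \<and>
      (\<forall>ys. length ys = k \<and> (\<forall>i<k. ys ! i \<in> U i) \<longrightarrow> ys \<in> S))" by (elim exE) (rule that)
  obtain N2 where N2: "real N2 > 2 * real t / c" using reals_Archimedean2 by blast
  show ?case
  proof (intro exI[of _ "Suc (max N1 N2)"] allI impI)
    fix V :: "'a set" and S
    assume *: "finite V \<and> card V \<ge> Suc (max N1 N2) \<and> S \<subseteq> {ys. set ys \<subseteq> V \<and> length ys = Suc k} \<and>
      real (card S) \<ge> c * real (card V) ^ Suc k"
    then have V: "finite V" and S: "S \<subseteq> {ys. set ys \<subseteq> V \<and> length ys = Suc k}" by auto
    define n where "n = real (card V)"
    have n: "n > 0" "n \<ge> real N2" using * by (auto simp: n_def)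
    then have "2 * real t / c \<le> n" using N2 by linarith
    then have nt: "real t \<le> c / 2 * n" using Suc.prems by (simp add: field_simps)
    define L where "L = {ys. set ys \<subseteq> V \<and> length ys = k}"
    have finL: "finite L" and cardL: "real (card L) = n ^ k"
      using V by (auto simp: L_def n_def finite_lists_length_eq card_lists_length_eq)
    define D where "D = (\<lambda>ys. {v \<in> V. v # ys \<in> S})"
    have finD: "finite (D ys)" "card (D ys) \<le> card V" for ys
      using V by (auto simp: D_def intro: card_mono)
    have S_eq: "S = (\<lambda>(ys, v). v # ys) ` Sigma L D"
      using S by (auto simp: D_def L_def image_iff length_Suc_conv subset_iff)
    have "inj_on (\<lambda>(ys, v). v # ys) (Sigma L D)" by (auto simp: inj_on_def)
    then have "card S = card (Sigma L D)" by (subst S_eq) (rule card_image)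
    then have cardS: "card S = (\<Sum>ys\<in>L. card (D ys))" using finL finD by simp
    \<comment> \<open>Tails with many extensions. In the count below, a tail in \<open>H\<close> is
      charged an extra \<open>n\<close> and every tail \<open>c / 2 * n\<close>, half of the
      available average.\<close>
    define H where "H = {ys \<in> L. c / 2 * n \<le> real (card (D ys))}"
    have H: "c / 2 * n ^ k \<le> real (card H)"
    proof -
      have "c * n ^ Suc k \<le> (\<Sum>ys\<in>L. real (card (D ys)))"
        using * cardS by (simp add: n_def)
      also have "\<dots> \<le> (\<Sum>ys\<in>L. (if c / 2 * n \<le> real (card (D ys)) then n else 0) + c / 2 * n)"
        using finD Suc.prems by (intro sum_mono) (auto simp: n_def add_increasing2)
      also have "\<dots> = real (card H) * n + n ^ k * (c / 2 * n)"
        using finL by (simp add: sum.distrib H_def sum.If_cases Int_def cardL)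
      finally have "(c / 2 * n ^ k) * n \<le> real (card H) * n" by (simp add: algebra_simps)
      then show ?thesis using n by simp
    qed
    define \<T> where "\<T> = {T. T \<subseteq> V \<and> card T = t}"
    have fin\<T>: "finite \<T>" using V by (simp add: \<T>_def)
    have card\<T>: "real (card \<T>) \<le> n ^ t"
    proof (cases "t \<le> card V")
      case True
      then show ?thesis
        using binomial_le_pow[OF True] n_subsets[OF V, of t] by (simp add: \<T>_def n_def flip: of_nat_power)
    next
      case False
      then show ?thesis using n n_subsets[OF V, of t] by (simp add: \<T>_def binomial_eq_0)
    qed
    have "c' * n ^ k * n ^ t = c / 2 * n ^ k * (c / 2 * n / real t) ^ t"
      by (simp add: c'_def power_divide power_mult_distrib)
    also have "\<dots> \<le> real (card H) * (c / 2 * n / real t) ^ t"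
      using H n Suc.prems by (intro mult_right_mono) auto
    also have "\<dots> = (\<Sum>ys\<in>H. (c / 2 * n / real t) ^ t)" by simp
    also have "\<dots> \<le> (\<Sum>ys\<in>H. real (card {T \<in> \<T>. T \<subseteq> D ys}))"
    proof (rule sum_mono)
      fix ys assume "ys \<in> H"
      then have D: "c / 2 * n \<le> real (card (D ys))" by (simp add: H_def)
      then have "t \<le> card (D ys)" using nt by linarith
      then have "(real (card (D ys)) / real t) ^ t \<le> real (card (D ys) choose t)"
        by (rule binomial_ge_n_over_k_pow_k)
      moreover have "(c / 2 * n / real t) ^ t \<le> (real (card (D ys)) / real t) ^ t"
        using D n Suc.prems by (intro power_mono divide_right_mono) auto
      moreover have "{T \<in> \<T>. T \<subseteq> D ys} = {T. T \<subseteq> D ys \<and> card T = t}"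
        by (auto simp: \<T>_def D_def)
      ultimately show "(c / 2 * n / real t) ^ t \<le> real (card {T \<in> \<T>. T \<subseteq> D ys})"
        using n_subsets[OF finD(1), of ys t] by simp
    qed
    also have "\<dots> \<le> (\<Sum>ys\<in>L. real (card {T \<in> \<T>. T \<subseteq> D ys}))"
      by (rule sum_mono2[OF finL]) (auto simp: H_def)
    also have "\<dots> = (\<Sum>ys\<in>L. \<Sum>T\<in>\<T>. if T \<subseteq> D ys then 1 else 0)"
      using fin\<T> by (simp add: sum.If_cases Int_def)
    also have "\<dots> = (\<Sum>T\<in>\<T>. \<Sum>ys\<in>L. if T \<subseteq> D ys then 1 else 0)" by (rule sum.swap)
    also have "\<dots> = (\<Sum>T\<in>\<T>. real (card {ys \<in> L. T \<subseteq> D ys}))"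
      using finL by (simp add: sum.If_cases Int_def)
    finally have big: "c' * n ^ k * n ^ t \<le> (\<Sum>T\<in>\<T>. real (card {ys \<in> L. T \<subseteq> D ys}))" .
    \<comment> \<open>Pigeonhole: one set \<open>T\<close> extends so many tails that the induction
      hypothesis applies to those tails.\<close>
    have "\<exists>T\<in>\<T>. c' * n ^ k \<le> real (card {ys \<in> L. T \<subseteq> D ys})"
    proof (rule ccontr)
      assume "\<not> ?thesis"
      then have less: "\<And>T. T \<in> \<T> \<Longrightarrow> real (card {ys \<in> L. T \<subseteq> D ys}) < c' * n ^ k" by force
      have "0 < c' * n ^ k * n ^ t" using c' n by simp
      then have "\<T> \<noteq> {}" using big by auto
      then have "card \<T> > 0" using fin\<T> by (simp add: card_gt_0_iff)
      from sum_bounded_above_strict[OF less this]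
      have "(\<Sum>T\<in>\<T>. real (card {ys \<in> L. T \<subseteq> D ys})) < real (card \<T>) * (c' * n ^ k)" by simp
      also have "\<dots> \<le> n ^ t * (c' * n ^ k)" using card\<T> c' n by (intro mult_right_mono) auto
      finally show False using big by (simp add: mult.commute)
    qed
    then obtain T where T: "T \<subseteq> V" "card T = t" "c' * n ^ k \<le> real (card {ys \<in> L. T \<subseteq> D ys})"
      by (auto simp: \<T>_def)
    have "\<exists>U. (\<forall>i<k. U i \<subseteq> V \<and> card (U i) = t) \<and>
        (\<forall>ys. length ys = k \<and> (\<forall>i<k. ys ! i \<in> U i) \<longrightarrow> ys \<in> {ys \<in> L. T \<subseteq> D ys})"
      by (rule N1[rule_format]) (use V * T(3) in \<open>auto simp: L_def n_def\<close>)
    then obtain U where U: "\<forall>i<k. U i \<subseteq> V \<and> card (U i) = t"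
      and US: "\<forall>ys. length ys = k \<and> (\<forall>i<k. ys ! i \<in> U i) \<longrightarrow> ys \<in> {ys \<in> L. T \<subseteq> D ys}"
      by (elim exE conjE) (rule that)
    show "\<exists>U. (\<forall>i<Suc k. U i \<subseteq> V \<and> card (U i) = t) \<and>
        (\<forall>ys. length ys = Suc k \<and> (\<forall>i<Suc k. ys ! i \<in> U i) \<longrightarrow> ys \<in> S)"
    \<comment> \<open>The removed coordinate is the head of the list, so \<open>T\<close> becomes
      part 0 and the other parts shift by one.\<close>
    proof (intro exI[of _ "case_nat T U"] conjI allI impI)
      fix i assume "i < Suc k"
      then show "case_nat T U i \<subseteq> V" "card (case_nat T U i) = t"
        using U T by (auto split: nat.split)
    next
      fix zs :: "'a list" assume zs: "length zs = Suc k \<and> (\<forall>i<Suc k. zs ! i \<in> case_nat T U i)"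
      then obtain v ys where vy: "zs = v # ys" "length ys = k" by (auto simp: length_Suc_conv)
      have "v \<in> T" using zs vy by force
      moreover have "\<forall>i<k. ys ! i \<in> U i" using zs vy by force
      from US[THEN spec, THEN mp, OF conjI[OF vy(2) this]] have "T \<subseteq> D ys" by simp
      ultimately have "v \<in> D ys" by blast
      then show "zs \<in> S" by (simp add: D_def vy)
    qed
  qed
qed

section \<open>From dense tuples to the blow-up\<close>

theorem theorem3p1:
  fixes r t :: nat and a \<gamma> :: real
  assumes "r \<ge> 1" and "t \<ge> 1" and "3/2 < a" and "a \<le> 2" and "\<gamma> > 0"
  shows "\<exists>n0::nat. \<forall>n \<ge> n0. \<forall>(V :: 'a set) A.
           digraph V A \<and> card V = n \<and>
           e_a a A \<ge> a * real (turan_num r n) + \<gamma> * (real n)\<^sup>2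
           \<longrightarrow> contains_subdigraph V A (blowup_vertices r t) (blowup_arcs r t)"
proof -
  from many_transitive_lists[OF assms(1,5), where 'a = 'a] obtain c N1 where c: "c > 0"
    and N1: "\<forall>(V :: 'a set) A. digraph V A \<and> card V \<ge> N1 \<and>
      2 * real (f2 A) + 4 / 3 * real (f1 A) \<ge> (1 - 1 / real r + \<gamma>) * (real (card V))\<^sup>2 - real r \<longrightarrow>
      real (card (transitive_lists V A (Suc r))) \<ge> c * real (card V) ^ Suc r"
    by (elim exE conjE) (rule that)
  from dense_lists_contain_box[OF assms(2) c, of "Suc r", where 'a = 'a] obtain N2 where
    N2: "\<forall>(V :: 'a set) S. finite V \<and> card V \<ge> N2 \<and> S \<subseteq> {ys. set ys \<subseteq> V \<and> length ys = Suc r} \<and>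
      real (card S) \<ge> c * real (card V) ^ Suc r \<longrightarrow>
      (\<exists>U. (\<forall>i<Suc r. U i \<subseteq> V \<and> card (U i) = t) \<and>
        (\<forall>ys. length ys = Suc r \<and> (\<forall>i<Suc r. ys ! i \<in> U i) \<longrightarrow> ys \<in> S))"
    by (elim exE) (rule that)
  show ?thesis
  proof (intro exI[of _ "max N1 N2"] allI impI)
    fix n and V :: "'a set" and A
    assume n: "n \<ge> max N1 N2" and *: "digraph V A \<and> card V = n \<and>
      e_a a A \<ge> a * real (turan_num r n) + \<gamma> * (real n)\<^sup>2"
    then have dg: "digraph V A" and V: "finite V" "card V = n" and irr: "\<And>v. (v, v) \<notin> A"
      by (auto simp: digraph_def)
    have "(1 - 1 / real r + \<gamma>) * (real n)\<^sup>2 - real r \<le> 2 * real (turan_num r n) + \<gamma> * (real n)\<^sup>2"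
      using turan_num_lower[OF assms(1), of n] by (simp add: algebra_simps)
    \<comment> \<open>Normalising by \<open>2 / a\<close> does not shrink the
      \<open>\<gamma>\<close> term, since \<open>a\<close> is at most 2.\<close>
    also have "\<dots> \<le> 2 / a * (a * real (turan_num r n) + \<gamma> * (real n)\<^sup>2)"
    proof -
      have "1 \<le> 2 / a" using assms by simp
      then have "1 * (\<gamma> * (real n)\<^sup>2) \<le> 2 / a * (\<gamma> * (real n)\<^sup>2)"
        using assms by (intro mult_right_mono) auto
      then show ?thesis using assms by (simp add: distrib_left)
    qed
    also have "\<dots> \<le> 2 / a * e_a a A" using * assms by (intro mult_left_mono) auto
    \<comment> \<open>The lower bound on \<open>a\<close> enters here, as \<open>2 / a\<close> being
      at most \<open>4/3\<close>.\<close>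
    also have "\<dots> \<le> 2 * real (f2 A) + 4 / 3 * real (f1 A)"
    proof -
      have "2 / a \<le> 4 / 3" using assms by (simp add: field_simps)
      then have "2 / a * real (f1 A) \<le> 4 / 3 * real (f1 A)" by (intro mult_right_mono) auto
      then show ?thesis using assms by (simp add: e_a_def distrib_left)
    qed
    finally have "real (card (transitive_lists V A (Suc r))) \<ge> c * real (card V) ^ Suc r"
      using n V dg by (intro N1[rule_format]) simp
    then have "\<exists>U. (\<forall>i<Suc r. U i \<subseteq> V \<and> card (U i) = t) \<and>
        (\<forall>ys. length ys = Suc r \<and> (\<forall>i<Suc r. ys ! i \<in> U i) \<longrightarrow> ys \<in> transitive_lists V A (Suc r))"
      using n V by (intro N2[rule_format]) (auto simp: transitive_lists_def)
    then obtain U where U: "\<forall>i<Suc r. U i \<subseteq> V \<and> card (U i) = t"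
      and box: "\<forall>ys. length ys = Suc r \<and> (\<forall>i<Suc r. ys ! i \<in> U i) \<longrightarrow> ys \<in> transitive_lists V A (Suc r)"
      by (elim exE conjE) (rule that)
    have "\<exists>g. bij_betw g {..<t} (U i)" if "i < Suc r" for i
    proof -
      have "finite (U i)" "card (U i) = t" using U V(1) that by (auto intro: finite_subset)
      then show ?thesis using ex_bij_betw_nat_finite[of "U i"] by (simp add: atLeast0LessThan)
    qed
    then obtain g where g: "\<And>i. i < Suc r \<Longrightarrow> bij_betw (g i) {..<t} (U i)" by metis
    have gU: "g i k \<in> U i" if "i < Suc r" "k < t" for i k
      using bij_betwE[OF g[OF that(1)]] that(2) by blast
    have arc: "(g i k, g j l) \<in> A" if "i < j" "j < Suc r" "k < t" "l < t" for i j k l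
    proof -
      \<comment> \<open>A transversal through the two prescribed vertices; the other parts
        contribute their vertex number 0, which exists because \<open>t\<close> is at least
        1.\<close>
      let ?f = "\<lambda>h. if h = i then g i k else if h = j then g j l else g h 0"
      let ?ys = "map ?f [0..<Suc r]"
      have len: "length ?ys = Suc r" by simp
      have nth: "?ys ! h = ?f h" if "h < Suc r" for h
        using nth_map_upt[of h "Suc r" 0 ?f] that by (simp del: upt_Suc)
      have "?f h \<in> U h" if "h < Suc r" for h
        using gU that \<open>k < t\<close> \<open>l < t\<close> assms(2) by auto
      then have "\<forall>h<Suc r. ?ys ! h \<in> U h" using nth by presburger
      from box[THEN spec, THEN mp, OF conjI[OF len this]] have "sorted_wrt (\<lambda>u v. (u, v) \<in> A) ?ys"
        unfolding transitive_lists_def by blast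
      then have "(?ys ! i, ?ys ! j) \<in> A" using that len by (simp only: sorted_wrt_iff_nth_less)
      moreover have "?ys ! i = g i k" "?ys ! j = g j l"
        using that nth[of i] nth[of j] by (simp_all del: upt_Suc)
      ultimately show ?thesis by (simp only:)
    qed
    show "contains_subdigraph V A (blowup_vertices r t) (blowup_arcs r t)"
      unfolding contains_subdigraph_def
    proof (intro exI[of _ "\<lambda>(i, k). g i k"] conjI)
      show "inj_on (\<lambda>(i, k). g i k) (blowup_vertices r t)"
      proof (rule inj_onI, clarsimp simp: blowup_vertices_def)
        fix i k j l assume ij: "i < Suc r" "k < t" "j < Suc r" "l < t" and eq: "g i k = g j l"
        \<comment> \<open>A vertex common to two parts would carry a loop, by
          \<open>arc\<close>.\<close>
        have "i = j"
          using arc[of i j k l] arc[of j i l k] ij eq irr by (metis linorder_neqE_nat)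
        moreover have "k = l" if "i = j"
          using g[OF ij(1)] ij eq that by (auto simp: bij_betw_def inj_on_def)
        ultimately show "i = j \<and> k = l" by simp
      qed
      show "(\<lambda>(i, k). g i k) ` blowup_vertices r t \<subseteq> V"
        using gU U by (fastforce simp: blowup_vertices_def)
      show "\<forall>(x, y)\<in>blowup_arcs r t. ((\<lambda>(i, k). g i k) x, (\<lambda>(i, k). g i k) y) \<in> A"
        using arc by (auto simp: blowup_arcs_def)
    qed
  qed
qed

end
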